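(* Let $N\ge k\ge 0$ be integers and let $\{x_n\}_{n\geq 0}$ and $\{b_n\}_{n\geq 0}$ be two sequences of nonzero complex numbers such that $b_i\neq b_j$ for $0\leq i\neq j\leq N$, and such that none of the denominators below vanish. Then for all $x\ne0$, $$\sum_{n=k}^{N}b_n\frac{\theta(x_nb_n,x_n/b_n;p)}{\theta(x_nb_k,x_n/b_k;p)}\left(\prod_{i=n+1}^{N}\frac{\theta(x_ix,x_i/x;p)}{\theta(x_ib_k,x_i/b_k;p)}\right)\frac{\prod_{i=0}^{n-1}\theta(b_ix,b_i/x;p)}{\prod_{i=0,\,i\neq k}^{n}\theta(b_ib_k,b_i/b_k;p)}=b_k\prod_{i=0,\,i\neq k}^{N}\frac{\theta(b_ix,b_i/x;p)}{\theta(b_ib_k,b_i/b_k;p)}.$$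
   Context: Let $p\in\mathbb{C}$, $|p|<1$. The modified Jacobi theta function is $\theta(x;p)=\prod_{n=0}^{\infty}(1-xp^n)(1-p^{n+1}/x)$ for $x\ne 0$, and $\theta(x_1,\dots,x_m;p)=\prod_{k=1}^m\theta(x_k;p)$. Empty products equal $1$. *)

theory Defs
  imports "HOL-Analysis.Analysis"
begin

text \<open>
  The modified Jacobi theta function, for \<open>norm p < 1\<close> and \<open>x \<noteq> 0\<close>.  In the library an
  infinite product may have finitely many zero factors, its value then being 0, so
  \<^const>\<open>prodinf\<close> also gives the intended value at the zeros of theta.  The value at \<open>x = 0\<close>
  is meaningless.
\<close>

definition jtheta :: "complex \<Rightarrow> complex \<Rightarrow> complex" where
  "jtheta x p = (\<Prod>n. (1 - x * p ^ n) * (1 - p ^ (n + 1) / x))"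

text \<open>\<open>jthetas [x\<^sub>1, \<dots>, x\<^sub>m] p\<close> is the multi-argument theta function.\<close>

definition jthetas :: "complex list \<Rightarrow> complex \<Rightarrow> complex" where
  "jthetas xs p = (\<Prod>x\<leftarrow>xs. jtheta x p)"

lemma jtheta_has_prod:
  assumes "norm p < 1"
  shows "(\<lambda>n. (1 - x * p ^ n) * (1 - p ^ (n + 1) / x)) has_prod jtheta x p"
proof -
  have s: "summable (\<lambda>n. norm (p ^ n))"
    using assms by (simp add: norm_power summable_geometric)
  have "summable (\<lambda>n. norm (1 + (- x) * p ^ n - 1))"
    using summable_mult[OF s, of "norm x"] by (simp add: norm_mult)
  hence "abs_convergent_prod (\<lambda>n. 1 + (- x) * p ^ n)"
    by (subst abs_convergent_prod_conv_summable)
  moreover have "summable (\<lambda>n. norm (1 + (- p / x) * p ^ n - 1))"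
    using summable_mult[OF s, of "norm (p / x)"] by (simp add: norm_mult norm_divide)
  hence "abs_convergent_prod (\<lambda>n. 1 + (- p / x) * p ^ n)"
    by (subst abs_convergent_prod_conv_summable)
  ultimately have "convergent_prod (\<lambda>n. (1 + (- x) * p ^ n) * (1 + (- p / x) * p ^ n))"
    by (intro convergent_prod_mult abs_convergent_prod_imp_convergent_prod)
  thus ?thesis
    by (simp add: jtheta_def convergent_prod_has_prod)
qed

end

theory Submission
  imports Defs
begin

text \<open>
  Abbreviate \<open>T a c = \<theta>(a c, a/c; p)\<close>.  The identity is proved by induction on \<open>N\<close>.  For
  \<open>N = k\<close> only the term \<open>n = k\<close> is left and the claim is immediate.  Passing from \<open>N\<close> to
  \<open>N + 1\<close> multiplies the old terms by \<open>T x\<^sub>N\<^sub>+\<^sub>1 x / T x\<^sub>N\<^sub>+\<^sub>1 b\<^sub>k\<close> and adds one new term.  After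
  removing the common product, the step is exactly Weierstrass' three-term relation for theta
  functions, \<open>weierstrass_three_term\<close>.

  The three-term relation is a Pluecker relation in disguise: there are functions \<open>g\<close> and \<open>h\<close>
  with \<open>T a c = a (g a h c - h a g c)\<close> (\<open>jthetas_determinant\<close>), and any two-by-two determinants
  \<open>D(a,c) = g a h c - h a g c\<close> satisfy \<open>D(w,x) D(v,u) + D(w,v) D(u,x) = D(v,x) D(w,u)\<close>.

  The determinant form comes from the Laurent expansion of theta.  By Jacobi's triple product
  identity (\<open>jacobi_triple_product\<close>), theta is up to a constant the sum over the integers \<open>m\<close> of
  \<open>p^(m(m-1)/2) (-z)^m\<close>.  In the double series for \<open>\<theta>(xy; p) \<theta>(x/y; p)\<close> the pairs \<open>(m,n)\<close> whose
  sum is even and those whose sum is odd are each parametrised by all pairs \<open>(j,l)\<close> of integers,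
  with \<open>m\<close> and \<open>n\<close> essentially \<open>j + l\<close> and \<open>j - l\<close>.  This diagonalises the
  quadratic form in the exponent, so each of the two parts factors into a function of \<open>x\<close> times
  a function of \<open>y\<close>.

  The triple product identity itself is obtained from a finite version, a form of the
  \<open>q\<close>-binomial theorem, by dominated convergence.
\<close>

section \<open>A finite form of the triple product identity\<close>


definition euler_prod :: "complex \<Rightarrow> nat \<Rightarrow> complex" where
  "euler_prod p n = (\<Prod>i<n. 1 - p ^ Suc i)"

text \<open>
  The reciprocal of \<open>(p; p)\<^sub>l\<close> for all integers \<open>l\<close>.  With the value 0 at negative \<open>l\<close> the recursion
  \<open>recip_euler_step\<close> holds without exception, and sums with finitely many terms can be written as
  sums over all integers, which makes index shifts free of boundary terms.
\<close>

definition recip_euler :: "complex \<Rightarrow> int \<Rightarrow> complex" where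
  "recip_euler p l = (if l < 0 then 0 else 1 / euler_prod p (nat l))"

text \<open>The terms of the Laurent series of theta, up to a constant factor.\<close>

definition theta_term :: "complex \<Rightarrow> complex \<Rightarrow> int \<Rightarrow> complex" where
  "theta_term p x l = p powi (l * (l - 1) div 2) * (- x) powi l"

lemma one_minus_power_nonzero:
  fixes p :: complex
  assumes "norm p < 1"
  shows "1 - p ^ Suc i \<noteq> 0"
proof -
  have "norm (p ^ Suc i) < 1"
    using power_Suc_less_one[of "norm p" i] assms by (cases "p = 0") (auto simp: norm_power norm_mult)
  thus ?thesis by (auto simp del: power_Suc)
qed

lemma euler_prod_nonzero: "norm p < 1 \<Longrightarrow> euler_prod p n \<noteq> 0"
  unfolding euler_prod_def prod_zero_iff[OF finite_lessThan] using one_minus_power_nonzero by blast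

lemma recip_euler_step:
  assumes "norm p < 1" "p \<noteq> 0"
  shows "recip_euler p (l - 1) = (1 - p powi l) * recip_euler p l"
proof -
  consider "l < 0" | "l = 0" | n where "l = int (Suc n)"
    using pos_int_cases[of l] by (metis Suc_pred linorder_neqE_linordered_idom)
  thus ?thesis
  proof cases
    case 3
    have *: "nat (1 + int n) = Suc n" "p powi (1 + int n) = p ^ Suc n"
      by (simp_all add: nat_add_distrib) (metis power_int_of_nat of_nat_Suc power_Suc)
    show ?thesis
      using 3 one_minus_power_nonzero[OF assms(1), of n]
      by (simp add: recip_euler_def * euler_prod_def)
  qed (auto simp: recip_euler_def)
qed

lemma theta_term_Suc:
  assumes "p \<noteq> 0" "x \<noteq> 0"
  shows "theta_term p x (l + 1) = - x * p powi l * theta_term p x l"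
proof -
  have "(l + 1) * (l + 1 - 1) = l * (l - 1) + l * 2" by (simp add: algebra_simps)
  hence "(l + 1) * (l + 1 - 1) div 2 = l * (l - 1) div 2 + l"
    by simp
  thus ?thesis using assms by (simp add: theta_term_def power_int_add)
qed

lemma theta_term_pred:
  assumes "p \<noteq> 0" "x \<noteq> 0"
  shows "theta_term p x (l - 1) = - (p powi (1 - l) / x) * theta_term p x l"
proof -
  have "p powi (1 - l) * p powi (l - 1) = 1"
    using assms by (simp flip: power_int_add)
  thus ?thesis
    using theta_term_Suc[OF assms, of "l - 1"] assms by (simp add: field_simps)
qed

text \<open>
  Multiplying the product by its next two factors \<open>1 + p\<^sup>2\<^sup>n\<^sup>+\<^sup>1 - x p\<^sup>n - p\<^sup>n\<^sup>+\<^sup>1 / x\<close> turns the sum into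
  a combination of the sum and its two shifts by one.  The recursions for the coefficients then
  reduce the comparison of the terms at each \<open>l\<close> to a polynomial identity in \<open>p\<^sup>n\<^sup>+\<^sup>1\<^sup>+\<^sup>l\<close>,
  \<open>p\<^sup>n\<^sup>+\<^sup>1\<^sup>-\<^sup>l\<close> and \<open>1 / p\<close>.
\<close>

lemma finite_jacobi_triple_product:
  assumes p: "norm p < 1" "p \<noteq> 0" and x: "x \<noteq> 0"
  shows "((\<lambda>l. euler_prod p (2 * n) * recip_euler p (int n + l) * recip_euler p (int n - l)
            * theta_term p x l)
          has_sum (\<Prod>i<n. (1 - x * p ^ i) * (1 - p ^ (i + 1) / x))) UNIV"
proof (induction n)
  case 0
  show ?case
    by (rule has_sum_finite_neutralI[of "{0}"])
       (auto simp: recip_euler_def euler_prod_def theta_term_def)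
next
  case (Suc n)
  define E where "E = euler_prod p (2 * n)"
  define t where "t = (\<lambda>l. E * recip_euler p (int n + l) * recip_euler p (int n - l) * theta_term p x l)"
  define P where "P = (\<Prod>i<n. (1 - x * p ^ i) * (1 - p ^ (i + 1) / x))"
  have t: "(t has_sum P) UNIV" using Suc unfolding t_def P_def E_def .
  have t1: "((\<lambda>l. t (l - 1)) has_sum P) UNIV"
    using t by (subst has_sum_reindex_bij_betw[of "\<lambda>l. l - 1" UNIV UNIV]) (auto intro!: o_bij[of "\<lambda>l. l + 1"])
  have t2: "((\<lambda>l. t (l + 1)) has_sum P) UNIV"
    using t by (subst has_sum_reindex_bij_betw[of "\<lambda>l. l + 1" UNIV UNIV]) (auto intro!: o_bij[of "\<lambda>l. l - 1"])
  have sum: "((\<lambda>l. (1 + p ^ (2 * n + 1)) * t l + (- (x * p ^ n) * t (l - 1) + - (p ^ (n + 1) / x) * t (l + 1)))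
      has_sum ((1 + p ^ (2 * n + 1)) * P + (- (x * p ^ n) * P + - (p ^ (n + 1) / x) * P))) UNIV"
    by (intro has_sum_add has_sum_cmult_right t t1 t2)
  have val: "(1 + p ^ (2 * n + 1)) * P + (- (x * p ^ n) * P + - (p ^ (n + 1) / x) * P)
      = (\<Prod>i<Suc n. (1 - x * p ^ i) * (1 - p ^ (i + 1) / x))"
    unfolding prod.lessThan_Suc P_def[symmetric]
    using x by (simp add: field_simps power_add mult_2_right)
  have E: "euler_prod p (2 * Suc n) = E * (1 - p ^ (2 * n + 1)) * (1 - p ^ (2 * n + 2))"
    by (simp add: euler_prod_def E_def)
  have "(1 + p ^ (2 * n + 1)) * t l + (- (x * p ^ n) * t (l - 1) + - (p ^ (n + 1) / x) * t (l + 1))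
      = euler_prod p (2 * Suc n) * recip_euler p (int (Suc n) + l) * recip_euler p (int (Suc n) - l)
        * theta_term p x l" for l
  proof -
    \<comment> \<open>Everything is expressed by \<open>u\<close>, \<open>v\<close>, \<open>p\<close> and the common factor \<open>E * r * s * T\<close>.\<close>
    define a where "a = int n + 1 + l"
    define c where "c = int n + 1 - l"
    define u where "u = p powi a"
    define v where "v = p powi c"
    define r where "r = recip_euler p a"
    define s where "s = recip_euler p c"
    define T where "T = theta_term p x l"
    have step: "recip_euler p (m - 1) = (1 - p powi m) * recip_euler p m" for m
      using recip_euler_step[OF p] .
    have ra: "recip_euler p (a - 1) = (1 - u) * r" and rc: "recip_euler p (c - 1) = (1 - v) * s"
      using step by (simp_all add: u_def v_def r_def s_def)
    have ra2: "recip_euler p (a - 2) = (1 - u / p) * ((1 - u) * r)"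
      using step[of "a - 1"] ra p by (simp add: u_def power_int_diff)
    have rc2: "recip_euler p (c - 2) = (1 - v / p) * ((1 - v) * s)"
      using step[of "c - 1"] rc p by (simp add: v_def power_int_diff)
    have e0: "t l = E * ((1 - u) * r) * ((1 - v) * s) * T"
      unfolding t_def T_def ra[symmetric] rc[symmetric] by (simp add: a_def c_def)
    have e1: "t (l - 1) = E * ((1 - u / p) * ((1 - u) * r)) * s * (- (p powi (1 - l) / x) * T)"
      unfolding t_def T_def ra2[symmetric] theta_term_pred[OF p(2) x, symmetric]
      by (simp add: a_def c_def s_def algebra_simps)
    have e2: "t (l + 1) = E * r * ((1 - v / p) * ((1 - v) * s)) * (- x * p powi l * T)"
      unfolding t_def T_def rc2[symmetric] theta_term_Suc[OF p(2) x, symmetric]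
      by (simp add: a_def c_def r_def algebra_simps)
    have v': "p ^ n * p powi (1 - l) = v"
      using p by (simp add: v_def c_def power_int_add power_int_diff)
    have u': "p ^ (n + 1) * p powi l = u"
      using p by (simp add: u_def a_def power_int_add)
    have uv: "p ^ (2 * n + 2) = u * v"
      using p unfolding u_def v_def a_def c_def power_int_add[symmetric]
      by (simp add: power_int_add power_int_diff mult_2 power_add)
    have uvp: "p ^ (2 * n + 1) = u * v / p"
      using p uv by (simp add: field_simps)
    have "- (x * p ^ n) * t (l - 1) = v * (E * ((1 - u / p) * ((1 - u) * r)) * s * T)"
      unfolding e1 v'[symmetric] using x by (simp add: field_simps)
    moreover have "- (p ^ (n + 1) / x) * t (l + 1) = u * (E * r * ((1 - v / p) * ((1 - v) * s)) * T)"
      unfolding e2 u'[symmetric] using x by (simp add: field_simps)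
    moreover have "recip_euler p (int (Suc n) + l) = r" "recip_euler p (int (Suc n) - l) = s"
      by (simp_all add: r_def s_def a_def c_def algebra_simps)
    moreover have "(1 + u * v / p) * (E * ((1 - u) * r) * ((1 - v) * s) * T)
        + (v * (E * ((1 - u / p) * ((1 - u) * r)) * s * T) + u * (E * r * ((1 - v / p) * ((1 - v) * s)) * T))
        = E * (1 - u * v / p) * (1 - u * v) * r * s * T"
    proof -
      have "(1 + u * v * q) * (E * ((1 - u) * r) * ((1 - v) * s) * T)
        + (v * (E * ((1 - u * q) * ((1 - u) * r)) * s * T) + u * (E * r * ((1 - v * q) * ((1 - v) * s)) * T))
        = E * (1 - u * v * q) * (1 - u * v) * r * s * T" for q by algebra
      from this[of "inverse p"] show ?thesis by (simp only: divide_inverse)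
    qed
    ultimately show ?thesis
      unfolding e0 E uv uvp T_def[symmetric] by simp
  qed
  thus ?case using sum unfolding val by simp
qed

section \<open>Jacobi's triple product identity\<close>

text \<open>
  Tannery's theorem for two-sided series: an enumeration of the integers reduces it to the
  one-sided case.
\<close>

lemma has_sum_dominated:
  fixes f :: "nat \<Rightarrow> int \<Rightarrow> complex"
  assumes "\<And>n. (f n has_sum s n) UNIV" "\<And>l. (\<lambda>n. f n l) \<longlonglongrightarrow> g l"
    and "\<And>n l. norm (f n l) \<le> M l" "M summable_on UNIV" "s \<longlonglongrightarrow> S"
  shows "(g has_sum S) UNIV"
proof -
  have M: "summable (\<lambda>k. M (int_decode k))"
    using assms(4) by (intro summable_on_imp_summable) (simp add: summable_on_reindex_bij_betw[OF bij_int_decode])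
  have tannery: "eventually (\<lambda>n. summable (\<lambda>k. norm (f n (int_decode k)))) sequentially \<and>
      summable (\<lambda>k. norm (g (int_decode k))) \<and>
      (\<lambda>n. suminf (\<lambda>k. f n (int_decode k))) \<longlonglongrightarrow> suminf (\<lambda>k. g (int_decode k))"
    by (rule tannerys_theorem[where M = "\<lambda>k. M (int_decode k)"])
       (use assms M in \<open>auto intro: always_eventually\<close>)
  have "(\<lambda>k. f n (int_decode k)) sums s n" for n
    using assms(1) by (intro has_sum_imp_sums) (simp add: has_sum_reindex_bij_betw[OF bij_int_decode])
  hence "suminf (\<lambda>k. f n (int_decode k)) = s n" for n
    by (simp add: sums_iff)
  hence "suminf (\<lambda>k. g (int_decode k)) = S"
    using tannery assms(5) LIMSEQ_unique by auto
  hence "((\<lambda>k. g (int_decode k)) has_sum S) UNIV"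
    using tannery by (intro norm_summable_imp_has_sum) (auto dest: summable_norm_cancel simp: sums_iff)
  thus ?thesis by (simp add: has_sum_reindex_bij_betw[OF bij_int_decode])
qed

text \<open>
  The quotients of consecutive terms on the nonnegative side are \<open>- x p\<^sup>n\<close>, so the ratio test
  applies there; the reflection \<open>l \<mapsto> - l\<close> replaces \<open>x\<close> by \<open>p / x\<close> and reduces the other side
  to the same case.
\<close>

lemma theta_term_abs_summable:
  assumes "norm p < 1" "p \<noteq> 0" "x \<noteq> 0"
  shows "(\<lambda>l. norm (theta_term p x l)) summable_on UNIV"
proof -
  have nat: "(\<lambda>n. norm (theta_term p y (int n))) summable_on UNIV" if "y \<noteq> 0" for y
  proof -
    have "(\<lambda>n. norm y * norm p ^ n) \<longlonglongrightarrow> norm y * 0"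
      by (intro tendsto_intros LIMSEQ_power_zero) (use assms in auto)
    hence "eventually (\<lambda>n. norm y * norm p ^ n < 1 / 2) sequentially"
      by (intro order_tendstoD) auto
    then obtain N where N: "\<And>n. n \<ge> N \<Longrightarrow> norm y * norm p ^ n < 1 / 2"
      by (auto simp: eventually_at_top_linorder)
    have "summable (\<lambda>n. norm (theta_term p y (int n)))"
    proof (rule summable_ratio_test[of "1/2" N])
      fix n assume "n \<ge> N"
      have "norm (theta_term p y (int (Suc n))) = (norm y * norm p ^ n) * norm (theta_term p y (int n))"
        using theta_term_Suc[OF assms(2) that, of "int n"]
        by (simp add: norm_mult norm_power add.commute)
      also have "\<dots> \<le> 1 / 2 * norm (theta_term p y (int n))"
        using N[OF \<open>n \<ge> N\<close>] by (intro mult_right_mono) auto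
      finally show "norm (norm (theta_term p y (int (Suc n)))) \<le> 1 / 2 * norm (norm (theta_term p y (int n)))"
        by simp
    qed auto
    thus ?thesis by (simp add: summable_on_UNIV_nonneg_real_iff)
  qed
  have "theta_term p x (- l) = theta_term p (p / x) l" for l
  proof -
    have "(- l) * (- l - 1) = l * (l - 1) + l * 2" by (simp add: algebra_simps)
    hence "(- l) * (- l - 1) div 2 = l * (l - 1) div 2 + l" by simp
    moreover have "p powi l * (- x) powi (- l) = (- (p / x)) powi l"
      using assms by (simp add: power_int_minus divide_inverse flip: power_int_inverse power_int_mult_distrib)
    ultimately show ?thesis using assms
      by (simp add: theta_term_def power_int_add mult.assoc)
  qed
  hence neg: "(\<lambda>n. norm (theta_term p x (- int n))) summable_on UNIV"
    using nat[of "p / x"] assms by simp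
  have 1: "(\<lambda>l. norm (theta_term p x l)) summable_on (range int)"
    using nat[OF assms(3)] by (subst summable_on_reindex) (auto simp: o_def inj_on_def)
  have 2: "(\<lambda>l. norm (theta_term p x l)) summable_on (range (\<lambda>n. - int n))"
    using neg by (subst summable_on_reindex) (auto simp: o_def inj_on_def)
  have "range int \<union> range (\<lambda>n. - int n) = UNIV"
    by (auto simp: image_iff) (metis int_cases2)
  thus ?thesis using summable_on_union[OF 1 2] by simp
qed

lemma euler_prod_limit:
  assumes "norm p < 1"
  obtains L where "euler_prod p \<longlonglongrightarrow> L" "L \<noteq> 0"
proof -
  have "summable (\<lambda>i. norm (p ^ Suc i))"
    using assms by (subst summable_Suc_iff) (simp add: norm_power summable_geometric)
  hence conv: "convergent_prod (\<lambda>i. 1 - p ^ Suc i)"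
    by (intro abs_convergent_prod_imp_convergent_prod summable_imp_abs_convergent_prod) simp
  have "(\<lambda>n. euler_prod p (Suc n)) \<longlonglongrightarrow> prodinf (\<lambda>i. 1 - p ^ Suc i)"
    using convergent_prod_LIMSEQ[OF conv] unfolding euler_prod_def lessThan_Suc_atMost .
  hence "euler_prod p \<longlonglongrightarrow> prodinf (\<lambda>i. 1 - p ^ Suc i)"
    by (rule LIMSEQ_imp_Suc)
  moreover have "prodinf (\<lambda>i. 1 - p ^ Suc i) \<noteq> 0"
    by (rule prodinf_nonzero[OF conv one_minus_power_nonzero[OF assms]])
  ultimately show ?thesis by (rule that)
qed

text \<open>
  In the finite form the coefficient at each fixed \<open>l\<close> tends to \<open>1 / L\<close>, and it is bounded
  uniformly in \<open>n\<close> and \<open>l\<close> because \<open>(p; p)\<^sub>n\<close> and its reciprocal are bounded.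
\<close>

theorem jacobi_triple_product:
  assumes p: "norm p < 1" "p \<noteq> 0" and x: "x \<noteq> 0"
    and L: "euler_prod p \<longlonglongrightarrow> L" "L \<noteq> 0"
  shows "(theta_term p x has_sum L * jtheta x p) UNIV"
proof -
  define e where "e n l = euler_prod p (2 * n) * recip_euler p (int n + l) * recip_euler p (int n - l)" for n l
  have L': "(\<lambda>n. 1 / euler_prod p n) \<longlonglongrightarrow> 1 / L"
    using L by (intro tendsto_intros)
  obtain C where C: "\<And>n. norm (euler_prod p n) \<le> C" "C > 0"
    using convergent_imp_Bseq[of "euler_prod p"] L by (auto simp: convergent_def Bseq_def)
  obtain D where D: "\<And>n. norm (1 / euler_prod p n) \<le> D" "D > 0"
    using convergent_imp_Bseq[OF convergentI[OF L']] by (auto simp: Bseq_def)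
  have R: "norm (recip_euler p m) \<le> D" for m
    using D by (auto simp: recip_euler_def)
  have bound: "norm (e n l * theta_term p x l) \<le> C * D * D * norm (theta_term p x l)" for n l
    unfolding e_def norm_mult by (intro mult_mono C R) (use C D in auto)
  have lim: "(\<lambda>n. e n l * theta_term p x l) \<longlonglongrightarrow> L * (1 / L) * (1 / L) * theta_term p x l" for l
  proof -
    have *: "(\<lambda>n. recip_euler p (int n + m)) \<longlonglongrightarrow> 1 / L" for m
    proof -
      have "filterlim (\<lambda>n. nat (int n + m)) sequentially sequentially"
        unfolding filterlim_at_top eventually_at_top_linorder
        by (intro allI, rule_tac x = "nat (int Z - m)" in exI) auto
      hence "(\<lambda>n. 1 / euler_prod p (nat (int n + m))) \<longlonglongrightarrow> 1 / L"
        by (rule filterlim_compose[OF L'])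
      moreover have "eventually (\<lambda>n. recip_euler p (int n + m) = 1 / euler_prod p (nat (int n + m))) sequentially"
        unfolding eventually_at_top_linorder
        by (rule exI[of _ "nat (- m)"]) (auto simp: recip_euler_def)
      ultimately show ?thesis by (simp add: tendsto_cong)
    qed
    have "filterlim (\<lambda>n. 2 * n) sequentially (sequentially :: nat filter)"
      by (intro filterlim_subseq) (auto simp: strict_mono_def)
    hence "(\<lambda>n. euler_prod p (2 * n)) \<longlonglongrightarrow> L" by (rule filterlim_compose[OF L(1)])
    thus ?thesis
      unfolding e_def using *[of l] *[of "- l"] by (intro tendsto_mult tendsto_const) auto
  qed
  have dom: "(\<lambda>l. C * D * D * norm (theta_term p x l)) summable_on UNIV"
    by (intro summable_on_cmult_right theta_term_abs_summable p x)
  have prod: "(\<lambda>n. \<Prod>i<n. (1 - x * p ^ i) * (1 - p ^ (i + 1) / x)) \<longlonglongrightarrow> jtheta x p"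
    using has_prod_imp_tendsto'[OF jtheta_has_prod[OF p(1)]] .
  have "((\<lambda>l. L * (1 / L) * (1 / L) * theta_term p x l) has_sum jtheta x p) UNIV"
    by (rule has_sum_dominated[OF finite_jacobi_triple_product[OF p x, folded e_def] lim bound dom prod])
  from has_sum_cmult_right[OF this, of L] show ?thesis using L by simp
qed

section \<open>Products of two theta functions\<close>

lemma has_sum_product:
  fixes f :: "'a \<Rightarrow> complex" and g :: "'b \<Rightarrow> complex"
  assumes "(f has_sum a) A" "(g has_sum b) B"
    and "(\<lambda>x. norm (f x)) summable_on A" "(\<lambda>x. norm (g x)) summable_on B"
  shows "((\<lambda>(x, y). f x * g y) has_sum a * b) (A \<times> B)"
proof (rule has_sum_SigmaI)
  show "((\<lambda>y. case (x, y) of (x, y) \<Rightarrow> f x * g y) has_sum f x * b) B" for x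
    using has_sum_cmult_right[OF assms(2)] by simp
  show "((\<lambda>x. f x * b) has_sum a * b) A"
    by (rule has_sum_cmult_left[OF assms(1)])
  have "(\<lambda>y. norm (f x * g y)) summable_on B" for x
    unfolding norm_mult by (intro summable_on_cmult_right assms)
  moreover have "(\<lambda>x. norm (\<Sum>\<^sub>\<infinity>y\<in>B. norm (f x * g y))) summable_on A"
    by (simp add: norm_mult infsum_cmult_right' infsum_nonneg summable_on_cmult_left assms(3))
  ultimately have "(\<lambda>z. norm (case z of (x, y) \<Rightarrow> f x * g y)) summable_on (A \<times> B)"
    by (intro iffD2[OF Infinite_Sum.abs_summable_on_Sigma_iff[where f = "\<lambda>(x, y). f x * g y" and A = A and B = "\<lambda>_. B"]]) simp
  thus "(\<lambda>(x, y). f x * g y) summable_on (A \<times> B)"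
    by (rule abs_summable_summable)
qed

text \<open>
  The exponents of \<open>p\<close> add up to \<open>j (j - 1) + l\<^sup>2\<close> when the two indices have an even sum and to
  \<open>j\<^sup>2 + l (l - 1)\<close> when it is odd, with no mixed term \<open>j l\<close>.  The
  factors are therefore again terms of theta series, now with base \<open>p\<^sup>2\<close>.
\<close>

lemma theta_term_mult:
  assumes "p \<noteq> 0" "x \<noteq> 0" "y \<noteq> 0"
  shows "theta_term p (x * y) (j + l) * theta_term p (x / y) (j - l)
           = theta_term (p\<^sup>2) (- x\<^sup>2) j * theta_term (p\<^sup>2) (- p * y\<^sup>2) l"
    and "theta_term p (x * y) (j + l) * theta_term p (x / y) (j - l + 1)
           = - (x / y) * (theta_term (p\<^sup>2) (- p * x\<^sup>2) j * theta_term (p\<^sup>2) (- y\<^sup>2) l)"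
proof -
  define A where "A = j * (j - 1) div 2"
  define B where "B = l * (l - 1) div 2"
  have AB: "j * (j - 1) = A * 2" "l * (l - 1) = B * 2"
    by (simp_all add: A_def B_def)
  have "(j + l) * (j + l - 1) = j * (j - 1) + l * (l - 1) + j * l * 2"
       "(j - l) * (j - l - 1) = j * (j - 1) + l * (l - 1) + (l - j * l) * 2"
       "(j - l + 1) * (j - l + 1 - 1) = j * (j - 1) + l * (l - 1) + (j - j * l) * 2"
    by (simp_all add: algebra_simps)
  hence e: "(j + l) * (j + l - 1) div 2 = A + B + j * l"
      "(j - l) * (j - l - 1) div 2 = A + B + l - j * l"
      "(j - l + 1) * (j - l + 1 - 1) div 2 = A + B + j - j * l"
    unfolding AB by simp_all
  have p2: "(p\<^sup>2) powi m = p powi (m + m)" for m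
    by (simp add: power_int_power)
  have xy: "(- (x * y)) powi (j + l) * (- (x / y)) powi (j - l) = (x\<^sup>2) powi j * (y\<^sup>2) powi l"
  proof -
    have "(- (x * y)) powi (j + l) * (- (x / y)) powi (j - l)
        = (- (x * y) * - (x / y)) powi j * (- (x * y) / - (x / y)) powi l"
      unfolding power_int_mult_distrib[of "- (x * y)" "- (x / y)"] power_int_divide_distrib[of "- (x * y)" "- (x / y)"]
      using assms by (simp add: power_int_add power_int_diff)
    thus ?thesis using assms by (simp add: power2_eq_square)
  qed
  show "theta_term p (x * y) (j + l) * theta_term p (x / y) (j - l)
           = theta_term (p\<^sup>2) (- x\<^sup>2) j * theta_term (p\<^sup>2) (- p * y\<^sup>2) l"
  proof -
    have "theta_term p (x * y) (j + l) * theta_term p (x / y) (j - l)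
        = p powi (A + B + j * l) * p powi (A + B + l - j * l)
          * ((- (x * y)) powi (j + l) * (- (x / y)) powi (j - l))"
      unfolding theta_term_def e by (simp add: mult_ac)
    also have "p powi (A + B + j * l) * p powi (A + B + l - j * l) = p powi (A + A) * p powi (B + B) * p powi l"
      using assms by (simp flip: power_int_add add: algebra_simps)
    finally show ?thesis
      unfolding xy by (simp add: theta_term_def p2 A_def B_def power_int_mult_distrib mult_ac)
  qed
  show "theta_term p (x * y) (j + l) * theta_term p (x / y) (j - l + 1)
           = - (x / y) * (theta_term (p\<^sup>2) (- p * x\<^sup>2) j * theta_term (p\<^sup>2) (- y\<^sup>2) l)"
  proof -
    have "theta_term p (x * y) (j + l) * theta_term p (x / y) (j - l + 1)
        = p powi (A + B + j * l) * p powi (A + B + j - j * l)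
          * ((- (x * y)) powi (j + l) * (- (x / y)) powi (j - l)) * - (x / y)"
      unfolding theta_term_def e using assms by (simp add: mult_ac power_int_add_1)
    also have "p powi (A + B + j * l) * p powi (A + B + j - j * l) = p powi (A + A) * p powi (B + B) * p powi j"
      using assms by (simp flip: power_int_add add: algebra_simps)
    finally show ?thesis
      unfolding xy by (simp add: theta_term_def p2 A_def B_def power_int_mult_distrib mult_ac)
  qed
qed

text \<open>
  The parity of \<open>m + n\<close> splits the double series for the left-hand side into two parts, which
  are the two products on the right.
\<close>

lemma jtheta_mult_expansion:
  assumes p: "norm p < 1" "p \<noteq> 0"
  obtains c where "\<And>x y. x \<noteq> 0 \<Longrightarrow> y \<noteq> 0 \<Longrightarrow>
    jtheta (x * y) p * jtheta (x / y) p
      = c * (jtheta (- x\<^sup>2) (p\<^sup>2) * jtheta (- p * y\<^sup>2) (p\<^sup>2)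
             - x / y * (jtheta (- p * x\<^sup>2) (p\<^sup>2) * jtheta (- y\<^sup>2) (p\<^sup>2)))"
proof -
  have q: "norm (p\<^sup>2) < 1" "p\<^sup>2 \<noteq> 0"
    using p by (auto simp: norm_power power_less_one_iff)
  obtain L where L: "euler_prod p \<longlonglongrightarrow> L" "L \<noteq> 0" using euler_prod_limit[OF p(1)] .
  obtain K where K: "euler_prod (p\<^sup>2) \<longlonglongrightarrow> K" "K \<noteq> 0" using euler_prod_limit[OF q(1)] .
  have prod: "((\<lambda>(i, j). theta_term r z i * theta_term r w j)
      has_sum (M * jtheta z r) * (M * jtheta w r)) UNIV"
    if "norm r < 1" "r \<noteq> 0" "z \<noteq> 0" "w \<noteq> 0" "euler_prod r \<longlonglongrightarrow> M" "M \<noteq> 0" for r z w M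
    using has_sum_product[of "theta_term r z" UNIV "M * jtheta z r" "theta_term r w" UNIV "M * jtheta w r"]
      that by (simp add: jacobi_triple_product theta_term_abs_summable)
  have "jtheta (x * y) p * jtheta (x / y) p
      = (K / L)\<^sup>2 * (jtheta (- x\<^sup>2) (p\<^sup>2) * jtheta (- p * y\<^sup>2) (p\<^sup>2)
             - x / y * (jtheta (- p * x\<^sup>2) (p\<^sup>2) * jtheta (- y\<^sup>2) (p\<^sup>2)))"
    if x: "x \<noteq> 0" and y: "y \<noteq> 0" for x y
  proof -
    define t where "t = (\<lambda>(m, n). theta_term p (x * y) m * theta_term p (x / y) n)"
    define ev where "ev = (\<lambda>(j, l). (j + l, j - l) :: int \<times> int)"
    define od where "od = (\<lambda>(j, l). (j + l, j - l + 1) :: int \<times> int)"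
    have total: "(t has_sum (L * jtheta (x * y) p) * (L * jtheta (x / y) p)) UNIV"
      unfolding t_def using prod[OF p _ _ L] x y by simp
    have "inj ev" "inj od" by (auto simp: inj_def ev_def od_def)
    have "((\<lambda>(j, l). theta_term (p\<^sup>2) (- x\<^sup>2) j * theta_term (p\<^sup>2) (- p * y\<^sup>2) l)
        has_sum (K * jtheta (- x\<^sup>2) (p\<^sup>2)) * (K * jtheta (- p * y\<^sup>2) (p\<^sup>2))) UNIV"
      using prod[OF q _ _ K] x y p by simp
    also have "(\<lambda>(j, l). theta_term (p\<^sup>2) (- x\<^sup>2) j * theta_term (p\<^sup>2) (- p * y\<^sup>2) l) = t \<circ> ev"
      unfolding t_def ev_def fun_eq_iff using theta_term_mult(1)[OF p(2) x y] by simp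
    finally have 1: "(t has_sum (K * jtheta (- x\<^sup>2) (p\<^sup>2)) * (K * jtheta (- p * y\<^sup>2) (p\<^sup>2))) (range ev)"
      using has_sum_reindex[OF \<open>inj ev\<close>] by blast
    have "((\<lambda>z. - (x / y) * (case z of (j, l) \<Rightarrow> theta_term (p\<^sup>2) (- p * x\<^sup>2) j * theta_term (p\<^sup>2) (- y\<^sup>2) l))
        has_sum - (x / y) * ((K * jtheta (- p * x\<^sup>2) (p\<^sup>2)) * (K * jtheta (- y\<^sup>2) (p\<^sup>2)))) UNIV"
      by (rule has_sum_cmult_right, rule prod[OF q _ _ K]) (use x y p in auto)
    also have "(\<lambda>z. - (x / y) * (case z of (j, l) \<Rightarrow> theta_term (p\<^sup>2) (- p * x\<^sup>2) j * theta_term (p\<^sup>2) (- y\<^sup>2) l)) = t \<circ> od"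
      unfolding t_def od_def fun_eq_iff using theta_term_mult(2)[OF p(2) x y] by simp
    finally have 2: "(t has_sum - (x / y) * ((K * jtheta (- p * x\<^sup>2) (p\<^sup>2)) * (K * jtheta (- y\<^sup>2) (p\<^sup>2)))) (range od)"
      using has_sum_reindex[OF \<open>inj od\<close>] by blast
    have disj: "range ev \<inter> range od = {}"
    proof -
      have "even (fst z + snd z)" if "z \<in> range ev" for z using that by (auto simp: ev_def)
      moreover have "odd (fst z + snd z)" if "z \<in> range od" for z using that by (auto simp: od_def)
      ultimately show ?thesis by blast
    qed
    have "(m, n) \<in> range ev \<union> range od" for m n
    proof (cases "even (m + n)")
      case True
      then obtain j where "m + n = 2 * j" by blast
      hence "(m, n) = ev (j, m - j)" by (simp add: ev_def)
      thus ?thesis by blast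
    next
      case False
      then obtain j where "m + n = 2 * j + 1" by (rule oddE)
      hence "(m, n) = od (j, m - j)" by (simp add: od_def)
      thus ?thesis by blast
    qed
    hence "range ev \<union> range od = UNIV" by auto
    with has_sum_Un_disjoint[OF 1 2 disj] have "(L * jtheta (x * y) p) * (L * jtheta (x / y) p)
        = (K * jtheta (- x\<^sup>2) (p\<^sup>2)) * (K * jtheta (- p * y\<^sup>2) (p\<^sup>2))
          + - (x / y) * ((K * jtheta (- p * x\<^sup>2) (p\<^sup>2)) * (K * jtheta (- y\<^sup>2) (p\<^sup>2)))"
      using has_sum_unique[OF total] by simp
    also have "\<dots> = K\<^sup>2 * (jtheta (- x\<^sup>2) (p\<^sup>2) * jtheta (- p * y\<^sup>2) (p\<^sup>2)
             - x / y * (jtheta (- p * x\<^sup>2) (p\<^sup>2) * jtheta (- y\<^sup>2) (p\<^sup>2)))"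
      by (simp add: algebra_simps power2_eq_square)
    finally have "(jtheta (x * y) p * jtheta (x / y) p) * L\<^sup>2
        = K\<^sup>2 * (jtheta (- x\<^sup>2) (p\<^sup>2) * jtheta (- p * y\<^sup>2) (p\<^sup>2)
             - x / y * (jtheta (- p * x\<^sup>2) (p\<^sup>2) * jtheta (- y\<^sup>2) (p\<^sup>2)))"
      by (simp only: power2_eq_square mult_ac)
    moreover have "a = (k / l)\<^sup>2 * z" if "a * l\<^sup>2 = k\<^sup>2 * z" "l \<noteq> 0" for a k l z :: complex
      using that by (simp add: power_divide nonzero_eq_divide_eq)
    ultimately show ?thesis using L(2) by blast
  qed
  thus ?thesis by (rule that)
qed

lemma jtheta_0: "jtheta x 0 = 1 - x"
proof -
  have "(\<lambda>n. (1 - x * 0 ^ n) * (1 - 0 ^ (n + 1) / x)) = (\<lambda>n. if n = 0 then 1 - x else 1)"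
    by auto
  thus ?thesis using prodinf_finite[of "{0}" "\<lambda>n. if n = 0 then 1 - x else 1"] by (simp add: jtheta_def)
qed

section \<open>The three-term relation\<close>

text \<open>
  For \<open>p \<noteq> 0\<close> this is the product formula above.  For \<open>p = 0\<close>, where
  the recursions for the Laurent terms would divide by 0, theta degenerates to \<open>1 - x\<close> and the
  functions can be read off from \<open>(1 - x y) (1 - x / y) = x ((x + 1 / x) - (y + 1 / y))\<close>.
\<close>

lemma jthetas_determinant:
  assumes p: "norm p < 1"
  obtains g h where "\<And>x y. x \<noteq> 0 \<Longrightarrow> y \<noteq> 0 \<Longrightarrow>
    jthetas [x * y, x / y] p = x * (g x * h y - h x * g y)"
proof (cases "p = 0")
  case True
  show ?thesis
    by (rule that[of "\<lambda>x. x + 1 / x" "\<lambda>_. 1"])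
       (simp add: True jthetas_def jtheta_0 field_simps)
next
  case False
  obtain c where c: "\<And>x y. x \<noteq> 0 \<Longrightarrow> y \<noteq> 0 \<Longrightarrow>
    jtheta (x * y) p * jtheta (x / y) p
      = c * (jtheta (- x\<^sup>2) (p\<^sup>2) * jtheta (- p * y\<^sup>2) (p\<^sup>2)
             - x / y * (jtheta (- p * x\<^sup>2) (p\<^sup>2) * jtheta (- y\<^sup>2) (p\<^sup>2)))"
    using jtheta_mult_expansion[OF p False] by blast
  show ?thesis
    by (rule that[of "\<lambda>x. c * jtheta (- x\<^sup>2) (p\<^sup>2) / x" "\<lambda>x. jtheta (- p * x\<^sup>2) (p\<^sup>2)"])
       (simp add: jthetas_def c right_diff_distrib)
qed

text \<open>
  With the determinant form inserted, the prefactors \<open>u\<close> and \<open>v\<close> balance the factors \<open>a\<close> in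
  \<open>T a c = a D(a,c)\<close>: each term carries the same factor \<open>u v w\<close>, and what is left is the Pluecker relation.
\<close>

lemma weierstrass_three_term:
  assumes p: "norm p < 1" and nz: "x \<noteq> 0" "u \<noteq> 0" "v \<noteq> 0" "w \<noteq> 0"
  shows "u * jthetas [w * x, w / x] p * jthetas [v * u, v / u] p
       + v * jthetas [w * v, w / v] p * jthetas [u * x, u / x] p
       = u * jthetas [v * x, v / x] p * jthetas [w * u, w / u] p"
proof -
  obtain g h where gh: "\<And>x y. x \<noteq> 0 \<Longrightarrow> y \<noteq> 0 \<Longrightarrow>
    jthetas [x * y, x / y] p = x * (g x * h y - h x * g y)"
    using jthetas_determinant[OF p] by blast
  show ?thesis
    unfolding gh[OF nz(4) nz(1)] gh[OF nz(3) nz(2)] gh[OF nz(4) nz(3)] gh[OF nz(2) nz(1)]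
      gh[OF nz(3) nz(1)] gh[OF nz(4) nz(2)]
    by (simp only: algebra_simps)
qed

section \<open>The summation formula\<close>

theorem corollary4p1:
  fixes p x :: complex and N k :: nat and xs b :: "nat \<Rightarrow> complex"
  assumes "norm p < 1"
    and "k \<le> N"
    and "\<And>n. xs n \<noteq> 0"
    and "\<And>n. b n \<noteq> 0"
    and "\<And>i j. i \<le> N \<Longrightarrow> j \<le> N \<Longrightarrow> i \<noteq> j \<Longrightarrow> b i \<noteq> b j"
    and "\<And>n. k \<le> n \<Longrightarrow> n \<le> N \<Longrightarrow> jthetas [xs n * b k, xs n / b k] p \<noteq> 0"
    and "\<And>i. i \<le> N \<Longrightarrow> i \<noteq> k \<Longrightarrow> jthetas [b i * b k, b i / b k] p \<noteq> 0"
    and "x \<noteq> 0"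
  shows "(\<Sum>n=k..N.
            b n * (jthetas [xs n * b n, xs n / b n] p / jthetas [xs n * b k, xs n / b k] p)
            * (\<Prod>i=n+1..N. jthetas [xs i * x, xs i / x] p / jthetas [xs i * b k, xs i / b k] p)
            * ((\<Prod>i<n. jthetas [b i * x, b i / x] p)
               / (\<Prod>i\<in>{0..n} - {k}. jthetas [b i * b k, b i / b k] p)))
       = b k * (\<Prod>i\<in>{0..N} - {k}. jthetas [b i * x, b i / x] p / jthetas [b i * b k, b i / b k] p)"
proof -
  define T where "T = (\<lambda>a c. jthetas [a * c, a / c] p)"
  define R where "R = (\<lambda>i. T (xs i) x / T (xs i) (b k))"
  define S where "S = (\<lambda>n. b n * (T (xs n) (b n) / T (xs n) (b k))
      * ((\<Prod>i<n. T (b i) x) / (\<Prod>i\<in>{0..n} - {k}. T (b i) (b k))))"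
  define Q where "Q = (\<lambda>M. \<Prod>i\<in>{0..M} - {k}. T (b i) x / T (b i) (b k))"
  \<comment> \<open>The upper limit varies up to \<open>N\<close>, since the hypotheses on the denominators reach only that far.\<close>
  have "M \<le> N \<Longrightarrow> (\<Sum>n=k..M. S n * (\<Prod>i=n+1..M. R i)) = b k * Q M" if "k \<le> M" for M
    using that
  proof (induction M rule: dec_induct)
    case base
    have "{0..k} - {k} = {..<k}" by auto
    thus ?case using assms(6)[of k] assms(2)
      by (simp add: S_def Q_def T_def prod_dividef)
  next
    case (step M)
    define X where "X = xs (Suc M)"
    define B where "B = b (Suc M)"
    \<comment> \<open>Old sum and new term, over the common denominator \<open>T X (b k) * T B (b k)\<close>, combine by the
      three-term relation at \<open>w = X\<close>, \<open>v = B\<close>, \<open>u = b k\<close>.\<close>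
    have nz: "T X (b k) \<noteq> 0" "T B (b k) \<noteq> 0"
      using assms(6)[of "Suc M"] assms(7)[of "Suc M"] step by (auto simp: T_def X_def B_def)
    have split: "{0..Suc M} - {k} = insert (Suc M) ({0..M} - {k})"
      using step by auto
    have QS: "Q (Suc M) = T B x / T B (b k) * Q M"
      unfolding Q_def split B_def by simp
    have "{..<Suc M} = insert k ({0..M} - {k})" using step by auto
    hence num: "(\<Prod>i<Suc M. T (b i) x) = T (b k) x * (\<Prod>i\<in>{0..M} - {k}. T (b i) x)"
      by (simp only: prod.insert_remove finite_atLeastAtMost finite_Diff Diff_idemp)
    have SS: "S (Suc M) = B * (T X B / T X (b k)) * (T (b k) x / T B (b k)) * Q M"
      unfolding S_def num split Q_def prod_dividef by (simp add: X_def B_def mult_ac)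
    have "(\<Sum>n=k..M. S n * (\<Prod>i=n+1..Suc M. R i)) = R (Suc M) * (\<Sum>n=k..M. S n * (\<Prod>i=n+1..M. R i))"
      unfolding sum_distrib_left by (intro sum.cong refl) (simp add: prod.nat_ivl_Suc')
    also have "\<dots> = T X x / T X (b k) * (b k * Q M)"
      using step by (simp add: R_def X_def)
    finally have "(\<Sum>n=k..Suc M. S n * (\<Prod>i=n+1..Suc M. R i))
        = (b k * T X x * T B (b k) + B * T X B * T (b k) x) / (T X (b k) * T B (b k)) * Q M"
      using step nz by (simp add: SS field_simps)
    also have "b k * T X x * T B (b k) + B * T X B * T (b k) x = b k * T B x * T X (b k)"
      unfolding T_def X_def B_def by (rule weierstrass_three_term) (use assms in auto)
    finally show ?case using nz by (simp add: QS)
  qed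
  from this[OF assms(2) order_refl] show ?thesis
    unfolding S_def R_def Q_def T_def by (simp only: mult_ac)
qed

end
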